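(* For any graph $G(V,E)$ (directed or undirected), suppose there exists an RDSS code for $G$ over $\mathbb{F}_q$ with distance $d$ and dimension $k$. Then $$d\ \le\ |V|-k+1-\max_{U\in\mathcal{I}(G):\ |N(U)|\le k-1}|U| ,$$ where for an undirected graph $\mathcal{I}(G)$ is the set of all independent sets of $G$, and for a directed graph $\mathcal{I}(G)$ is the set of vertex sets of all induced acyclic subgraphs of $G$.
   Context: Write $V=\{1,\dots,n\}$, and let $\mathbb{F}_q$ be the finite field with $q$ elements. For $i\in V$, $N(i)=\{u\in V:(i,u)\in E\}$. For $U\subset V$, $N(U)$ is the set of all vertices $w\in V\setminus U$ such that $(u,w)\in E$ for some $u\in U$. For $X\in\mathbb{F}_q^n$ and $I\subseteq V$, $X_I$ denotes the projection of $X$ onto the coordinates in $I$. An RDSS (recoverable distributed storage system) code for $G$ is a set $\mathcal{C}\subseteq\mathbb{F}_q^n$ together with deterministic functions $f_i:\mathbb{F}_q^{|N(i)|}\to\mathbb{F}_q$, $i=1,\dots,n$, such that $X_i=f_i(X_{N(i)})$ for all $X\in\mathcal{C}$ and all $i$. Its dimension is $\log_q|\mathcal{C}|$. It is an RDSS code with distance $d$ if the Hamming distance between any two distinct codewords is at least $d$. *)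

theory Defs
  imports Complex_Main "HOL-Library.FuncSet" "HOL-Library.Cardinality"
begin

type_synonym edges = "(nat \<times> nat) set"

abbreviation vertices :: "nat \<Rightarrow> nat set" where
  "vertices n \<equiv> {1..n}"

text \<open>Undirected graphs are the digraphs whose edge relation is symmetric. Loops are not excluded.\<close>

definition digraph :: "nat \<Rightarrow> edges \<Rightarrow> bool" where
  "digraph n E \<longleftrightarrow> E \<subseteq> vertices n \<times> vertices n"

definition undirected_graph :: "nat \<Rightarrow> edges \<Rightarrow> bool" where
  "undirected_graph n E \<longleftrightarrow> digraph n E \<and> sym E"

definition nbrs :: "nat \<Rightarrow> edges \<Rightarrow> nat \<Rightarrow> nat set" where
  "nbrs n E i = {u \<in> vertices n. (i, u) \<in> E}"

definition set_nbrs :: "nat \<Rightarrow> edges \<Rightarrow> nat set \<Rightarrow> nat set" where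
  "set_nbrs n E U = {w \<in> vertices n - U. \<exists>u\<in>U. (u, w) \<in> E}"

definition independent_sets :: "nat \<Rightarrow> edges \<Rightarrow> nat set set" where
  "independent_sets n E = {U. U \<subseteq> vertices n \<and> (\<forall>u\<in>U. \<forall>v\<in>U. (u, v) \<notin> E)}"

definition acyclic_induced_sets :: "nat \<Rightarrow> edges \<Rightarrow> nat set set" where
  "acyclic_induced_sets n E = {U. U \<subseteq> vertices n \<and> acyclic (E \<inter> U \<times> U)}"

text \<open>Words of length \<open>n\<close> are the extensional functions on \<open>{1..n}\<close>; the projection
  of a word \<open>X\<close> onto the coordinates in \<open>I\<close> is \<open>restrict X I\<close>.\<close>

definition words :: "nat \<Rightarrow> (nat \<Rightarrow> 'a) set" where
  "words n = vertices n \<rightarrow>\<^sub>E UNIV"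

definition hamming_dist :: "nat \<Rightarrow> (nat \<Rightarrow> 'a) \<Rightarrow> (nat \<Rightarrow> 'a) \<Rightarrow> nat" where
  "hamming_dist n X Y = card {i \<in> vertices n. X i \<noteq> Y i}"

definition rdss_code :: "nat \<Rightarrow> edges \<Rightarrow> (nat \<Rightarrow> 'a::{field,finite}) set \<Rightarrow> bool" where
  "rdss_code n E C \<longleftrightarrow> C \<subseteq> words n \<and>
     (\<exists>f :: nat \<Rightarrow> (nat \<Rightarrow> 'a) \<Rightarrow> 'a.
        \<forall>X\<in>C. \<forall>i\<in>vertices n. X i = f i (restrict X (nbrs n E i)))"

definition code_dim :: "(nat \<Rightarrow> 'a::{field,finite}) set \<Rightarrow> real" where
  "code_dim C = log (real CARD('a)) (real (card C))"

definition has_distance :: "nat \<Rightarrow> (nat \<Rightarrow> 'a) set \<Rightarrow> nat \<Rightarrow> bool" where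
  "has_distance n C d \<longleftrightarrow> (\<forall>X\<in>C. \<forall>Y\<in>C. X \<noteq> Y \<longrightarrow> d \<le> hamming_dist n X Y)"

text \<open>The largest size of a set in the family \<open>F\<close> with at most \<open>k - 1\<close> neighbours.
  Inserting \<open>0\<close> has no effect if \<open>k \<ge> 1\<close> and \<open>{} \<in> F\<close>; it fixes the value \<open>0\<close> for \<open>k < 1\<close>,
  where no set is admissible.\<close>

definition max_admissible_size :: "nat \<Rightarrow> edges \<Rightarrow> nat set set \<Rightarrow> real \<Rightarrow> nat" where
  "max_admissible_size n E F k =
     Max (insert 0 (card ` {U \<in> F. real (card (set_nbrs n E U)) \<le> k - 1}))"

end

theory Submission
  imports Defs
begin

text \<open>The coordinates outside \<open>U\<close> that neighbour \<open>U\<close> determine the coordinates in an acyclic \<open>U\<close>,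
  by well-founded recursion along the edges. Enlarge \<open>N(U)\<close> to a set \<open>R\<close> of \<open>\<lceil>k\<rceil> - 1\<close> vertices
  outside \<open>U\<close>. As \<open>|R| < k\<close>, two distinct codewords agree on \<open>R\<close> by pigeonhole, hence on \<open>R \<union> U\<close>,
  so their distance is at most \<open>n - |U| - \<lceil>k\<rceil> + 1\<close>.\<close>

lemma rdss_code_agree:
  assumes code: "rdss_code n E C" and U: "U \<in> acyclic_induced_sets n E"
    and C: "X \<in> C" "Y \<in> C"
    and agree: "\<And>i. i \<in> set_nbrs n E U \<Longrightarrow> X i = Y i" and "i \<in> U"
  shows "X i = Y i"
proof -
  from code obtain f where f: "\<And>Z i. Z \<in> C \<Longrightarrow> i \<in> vertices n \<Longrightarrow> Z i = f i (restrict Z (nbrs n E i))"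
    unfolding rdss_code_def by blast
  have UV: "U \<subseteq> vertices n" and ac: "acyclic (E \<inter> U \<times> U)"
    using U by (auto simp: acyclic_induced_sets_def)
  have "finite (E \<inter> U \<times> U)"
    using UV by (meson finite_Int finite_SigmaI finite_atLeastAtMost finite_subset)
  \<comment> \<open>The converse is taken so that the induction hypothesis at \<open>i\<close>
    covers the out-neighbours of \<open>i\<close> inside \<open>U\<close>, whose symbols
    \<open>f i\<close> reads; finiteness turns acyclicity into well-foundedness.\<close>
  then have "wf ((E \<inter> U \<times> U)\<inverse>)"
    using ac by (rule finite_acyclic_wf_converse)
  then show ?thesis using \<open>i \<in> U\<close>
  proof (induction i rule: wf_induct_rule)
    case (less i)
    have "X j = Y j" if j: "j \<in> nbrs n E i" for j
    proof (cases "j \<in> U")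
      case True
      then show ?thesis using less j by (auto simp: nbrs_def)
    next
      case False
      then show ?thesis using less.prems j by (intro agree) (auto simp: nbrs_def set_nbrs_def)
    qed
    then have "restrict X (nbrs n E i) = restrict Y (nbrs n E i)"
      by (intro restrict_ext) auto
    then show ?case using f C less.prems UV by (metis subsetD)
  qed
qed

lemma two_le_card_field: "2 \<le> CARD('a::{field,finite})"
proof -
  have "card {0::'a, 1} \<le> CARD('a)" by (rule card_mono) auto
  then show ?thesis by simp
qed

lemma card_eq_powr_code_dim:
  fixes C :: "(nat \<Rightarrow> 'a::{field,finite}) set"
  assumes "card C > 0"
  shows "real (card C) = real CARD('a) powr code_dim C"
proof -
  show ?thesis using two_le_card_field[where 'a = 'a] assms by (simp add: code_dim_def)
qed

text \<open>There are only \<open>CARD('a) ^ card R\<close> patterns on \<open>R\<close>. Read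
  directly, this bounds the dimension by the size of an information set; read contrapositively, it
  is the pigeonhole principle for sets smaller than the dimension.\<close>

lemma code_dim_le_card_if_inj_on:
  fixes C :: "(nat \<Rightarrow> 'a::{field,finite}) set"
  assumes "card C > 0" and "finite R" and inj: "inj_on (\<lambda>X. restrict X R) C"
  shows "code_dim C \<le> real (card R)"
proof -
  note q = two_le_card_field[where 'a = 'a]
  have "card C \<le> card (R \<rightarrow>\<^sub>E (UNIV :: 'a set))"
    using inj by (rule card_inj_on_le) (auto intro: finite_PiE \<open>finite R\<close>)
  also have "\<dots> = CARD('a) ^ card R"
    using \<open>finite R\<close> by (simp add: card_PiE)
  finally have "real (card C) \<le> real CARD('a) ^ card R"
    by (metis of_nat_le_iff of_nat_power)
  then have "real CARD('a) powr code_dim C \<le> real CARD('a) powr real (card R)"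
    using q assms(1) by (simp add: card_eq_powr_code_dim powr_realpow)
  then show ?thesis using q by simp
qed

lemma has_distance_le_if_agree:
  assumes "has_distance n C d" "X \<in> C" "Y \<in> C" "X \<noteq> Y" "I \<subseteq> vertices n"
    and "\<And>i. i \<in> I \<Longrightarrow> X i = Y i"
  shows "d + card I \<le> n"
proof -
  have "d \<le> card {i \<in> vertices n. X i \<noteq> Y i}"
    using assms by (auto simp: has_distance_def hamming_dist_def)
  also have "\<dots> \<le> card (vertices n - I)"
    by (rule card_mono) (use assms in auto)
  also have "\<dots> = n - card I"
    using assms(5) by (simp add: card_Diff_subset finite_subset)
  finally show ?thesis
    using card_mono[OF _ assms(5)] by simp
qed

lemma rdss_code_distance_le:
  fixes C :: "(nat \<Rightarrow> 'a::{field,finite}) set"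
  assumes code: "rdss_code n E C" and dist: "has_distance n C d" and ne: "card C > 0"
    and U: "U \<in> acyclic_induced_sets n E"
    and N: "real (card (set_nbrs n E U)) \<le> code_dim C - 1"
  shows "real d \<le> real n - code_dim C + 1 - real (card U)"
proof -
  let ?W = "vertices n - U" and ?k = "code_dim C"
  \<comment> \<open>The largest integer strictly below the possibly non-integral dimension. The
    dimension is at least 1 by \<open>N\<close>, so the natural subtraction does not
    truncate.\<close>
  define m where "m = nat \<lceil>?k\<rceil> - 1"
  have k1: "?k \<ge> 1" using N by linarith
  then have m: "real m < ?k" "?k \<le> real m + 1" unfolding m_def by linarith+
  have UV: "U \<subseteq> vertices n" using U by (simp add: acyclic_induced_sets_def)
  then have finU: "finite U" by (rule finite_subset) simp
  have NW: "set_nbrs n E U \<subseteq> ?W" by (auto simp: set_nbrs_def)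
  \<comment> \<open>The symbols outside \<open>U\<close> determine the codeword, so the dimension is
    at most \<open>card ?W\<close>. This leaves room for a set \<open>R\<close> of size
    \<open>m\<close> outside \<open>U\<close>.\<close>
  have "inj_on (\<lambda>X. restrict X ?W) C"
  proof (rule inj_onI)
    fix X Y assume XY: "X \<in> C" "Y \<in> C" and eq: "restrict X ?W = restrict Y ?W"
    have W: "X i = Y i" if "i \<in> ?W" for i using fun_cong[OF eq, of i] that by simp
    have "X i = Y i" if "i \<in> vertices n" for i
      using W rdss_code_agree[OF code U XY] NW that by blast
    moreover have "X \<in> words n" "Y \<in> words n" using code XY by (auto simp: rdss_code_def)
    ultimately show "X = Y" unfolding words_def by (metis PiE_ext)
  qed
  then have "?k \<le> real (card ?W)" by (intro code_dim_le_card_if_inj_on ne) auto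
  then have "m \<le> card ?W" using m by linarith
  moreover have "card (set_nbrs n E U) \<le> m" using N m by linarith
  ultimately obtain R where R: "set_nbrs n E U \<subseteq> R" "R \<subseteq> ?W" "card R = m"
    using NW by (metis exists_subset_between finite_Diff finite_atLeastAtMost)
  have finR: "finite R" using R(2) by (rule finite_subset) simp
  have "\<not> inj_on (\<lambda>X. restrict X R) C"
    using code_dim_le_card_if_inj_on[OF ne finR] R(3) m by auto
  then obtain X Y where XY: "X \<in> C" "Y \<in> C" "X \<noteq> Y" and eq: "restrict X R = restrict Y R"
    by (auto simp: inj_on_def)
  have agR: "X i = Y i" if "i \<in> R" for i using fun_cong[OF eq, of i] that by simp
  have "d + card (R \<union> U) \<le> n"
  proof (rule has_distance_le_if_agree[OF dist XY])
    show "R \<union> U \<subseteq> vertices n" using R UV by auto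
    show "X i = Y i" if "i \<in> R \<union> U" for i
      using that agR R(1) rdss_code_agree[OF code U XY(1,2)] by blast
  qed
  moreover have "card (R \<union> U) = m + card U"
    using R finR finU by (subst card_Un_disjoint) auto
  ultimately show ?thesis using m by linarith
qed

lemma independent_sets_subset_acyclic_induced_sets:
  "independent_sets n E \<subseteq> acyclic_induced_sets n E"
proof
  fix U assume U: "U \<in> independent_sets n E"
  then have "E \<inter> U \<times> U = {}" by (auto simp: independent_sets_def)
  then show "U \<in> acyclic_induced_sets n E"
    using U by (simp add: independent_sets_def acyclic_induced_sets_def acyclic_def)
qed

text \<open>Stating this for a subfamily \<open>F\<close> serves directed and undirected graphs at
  once. The maximum is attained, either by an admissible set or by the inserted default 0.\<close>

lemma rdss_code_distance_le_max_admissible_size: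
  fixes C :: "(nat \<Rightarrow> 'a::{field,finite}) set"
  assumes code: "rdss_code n E C" and dist: "has_distance n C d" and "card C \<ge> 2"
    and F: "F \<subseteq> acyclic_induced_sets n E" "{} \<in> F"
  shows "real d \<le> real n - code_dim C + 1 - real (max_admissible_size n E F (code_dim C))"
proof -
  let ?k = "code_dim C"
  let ?S = "insert 0 (card ` {U \<in> F. real (card (set_nbrs n E U)) \<le> ?k - 1})"
  have ne: "card C > 0" using assms(3) by simp
  have "F \<subseteq> Pow (vertices n)" using F by (auto simp: acyclic_induced_sets_def)
  then have "finite F" by (rule finite_subset) simp
  then have "Max ?S \<in> ?S" by (intro Max_in) auto
  then consider "Max ?S = 0"
    | U where "U \<in> F" "real (card (set_nbrs n E U)) \<le> ?k - 1" "Max ?S = card U"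
    by (elim insertE imageE) blast+
  then show ?thesis
  proof cases
    case 1
    show ?thesis
    proof (cases "?k \<ge> 1")
      case True
      \<comment> \<open>Now the empty set is admissible, having no neighbours, and it yields the
        bound with size 0.\<close>
      then show ?thesis
        using rdss_code_distance_le[OF code dist ne, of "{}"] F 1
        by (auto simp: set_nbrs_def max_admissible_size_def)
    next
      case False
      \<comment> \<open>For dimension below 1 the right-hand side exceeds \<open>n\<close>, so
        \<open>d \<le> n\<close> suffices; it follows from any two distinct codewords.\<close>
      have "finite C" using ne by (rule card_ge_0_finite)
      then obtain X Y where "X \<in> C" "Y \<in> C" "X \<noteq> Y"
        using assms(3) card_le_Suc0_iff_eq[of C] by force
      then have "d + card ({} :: nat set) \<le> n" by (intro has_distance_le_if_agree[OF dist]) auto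
      then show ?thesis using False 1 by (simp add: max_admissible_size_def)
    qed
  next
    case 2
    then show ?thesis
      using rdss_code_distance_le[OF code dist ne, of U] F
      by (auto simp: max_admissible_size_def)
  qed
qed

theorem theorem14:
  fixes n d :: nat and k :: real
    and E :: edges
    and C :: "(nat \<Rightarrow> 'a::{field,finite}) set"
  assumes "rdss_code n E C"
    and "has_distance n C d"
    and "code_dim C = k"
    and "card C \<ge> 2"
  shows "(digraph n E \<longrightarrow>
            real d \<le> real (card (vertices n)) - k + 1
              - real (max_admissible_size n E (acyclic_induced_sets n E) k)) \<and>
         (undirected_graph n E \<longrightarrow>
            real d \<le> real (card (vertices n)) - k + 1
              - real (max_admissible_size n E (independent_sets n E) k))"
proof -
  have empty: "{} \<in> independent_sets n E" by (simp add: independent_sets_def)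
  note bound = rdss_code_distance_le_max_admissible_size[OF assms(1,2,4), unfolded assms(3)]
  show ?thesis
    \<comment> \<open>The empty set belongs to the acyclic family through the inclusion of the
      independent sets.\<close>
    using bound[OF subset_refl] bound[OF independent_sets_subset_acyclic_induced_sets empty]
      empty independent_sets_subset_acyclic_induced_sets[of n E]
    by auto
qed

end
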